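(* There exists an absolute constant $c>0$ such that for all integers $n\ge 5$, $$r_4(6,n)\ge 2^{2^{cn}}.$$
   Context: A $k$-uniform hypergraph ($k$-graph) $H$ consists of a vertex set $V(H)$ and a collection of $k$-element subsets of $V(H)$ called edges. $K_s^{(k)}$ denotes the complete $k$-graph on $s$ vertices. An independent set of $H$ is a set of vertices containing no edge of $H$. The off-diagonal Ramsey number $r_k(s,n)$ is the smallest integer $N$ such that every $k$-graph on $N$ vertices contains either a copy of $K_s^{(k)}$ or an independent set of size $n$. *)

theory Defs
  imports Complex_Main "HOL-Library.Ramsey"
begin

text \<open>A hypergraph is given by its vertex set \<open>V\<close> and its edge set \<open>E\<close>;
  \<open>[V]\<^bsup>k\<^esup>\<close> is the set of \<open>k\<close>-element subsets of \<open>V\<close>.\<close>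

definition kgraph :: "nat \<Rightarrow> 'a set \<Rightarrow> 'a set set \<Rightarrow> bool" where
  "kgraph k V E \<longleftrightarrow> finite V \<and> E \<subseteq> [V]\<^bsup>k\<^esup>"

definition contains_complete :: "nat \<Rightarrow> nat \<Rightarrow> 'a set \<Rightarrow> 'a set set \<Rightarrow> bool" where
  "contains_complete k s V E \<longleftrightarrow> (\<exists>S \<in> [V]\<^bsup>s\<^esup>. [S]\<^bsup>k\<^esup> \<subseteq> E)"

definition independent_set :: "'a set \<Rightarrow> 'a set set \<Rightarrow> 'a set \<Rightarrow> bool" where
  "independent_set V E I \<longleftrightarrow> I \<subseteq> V \<and> (\<forall>e \<in> E. \<not> e \<subseteq> I)"

definition ramsey_property :: "nat \<Rightarrow> nat \<Rightarrow> nat \<Rightarrow> 'a set \<Rightarrow> bool" where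
  "ramsey_property k s n V \<longleftrightarrow>
     (\<forall>E. kgraph k V E \<longrightarrow>
        contains_complete k s V E \<or> (\<exists>I. independent_set V E I \<and> card I = n))"

text \<open>Every finite hypergraph is isomorphic to one with vertices in \<^typ>\<open>nat\<close>, so it
  suffices to range over vertex sets of natural numbers. The minimum is attained, see
  \<open>ramsey_number_attained\<close> below.\<close>

definition ramsey_number :: "nat \<Rightarrow> nat \<Rightarrow> nat \<Rightarrow> nat" where
  "ramsey_number k s n =
     (LEAST N. \<forall>V :: nat set. finite V \<and> card V = N \<longrightarrow> ramsey_property k s n V)"

lemma ramsey_property_transfer:
  fixes U :: "'a set" and V :: "'b set"
  assumes U: "ramsey_property k s n U" and g: "bij_betw g U V"
  shows "ramsey_property k s n V"
  unfolding ramsey_property_def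
proof (intro allI impI)
  fix E assume E: "kgraph k V E"
  have inj: "inj_on g U" and im: "g ` U = V"
    using g by (auto simp: bij_betw_def)
  define F where "F = {e \<in> [U]\<^bsup>k\<^esup>. g ` e \<in> E}"
  have "kgraph k U F"
    using E bij_betw_finite[OF g] by (auto simp: kgraph_def F_def)
  with U consider S where "S \<in> [U]\<^bsup>s\<^esup>" "[S]\<^bsup>k\<^esup> \<subseteq> F"
    | I where "I \<subseteq> U" "\<forall>e \<in> F. \<not> e \<subseteq> I" "card I = n"
    unfolding ramsey_property_def contains_complete_def independent_set_def by blast
  then show "contains_complete k s V E \<or> (\<exists>I. independent_set V E I \<and> card I = n)"
  proof cases
    case 1
    have SU: "S \<subseteq> U" using 1 by (simp add: nsets_def)
    have injS: "inj_on g S" using inj SU by (rule inj_on_subset)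
    have "g ` S \<in> [V]\<^bsup>s\<^esup>"
      using 1 im card_image[OF injS] by (auto simp: nsets_def)
    moreover have "[g ` S]\<^bsup>k\<^esup> \<subseteq> E"
    proof
      fix e assume e: "e \<in> [g ` S]\<^bsup>k\<^esup>"
      then obtain d where d: "d \<subseteq> S" "e = g ` d"
        by (auto simp: nsets_def subset_image_iff)
      have "inj_on g d" using injS d(1) by (rule inj_on_subset)
      then have "d \<in> [S]\<^bsup>k\<^esup>"
        using e d by (auto simp: nsets_def card_image finite_image_iff)
      then show "e \<in> E" using 1 d by (auto simp: F_def)
    qed
    ultimately show ?thesis unfolding contains_complete_def by blast
  next
    case 2
    have injI: "inj_on g I" using inj 2(1) by (rule inj_on_subset)
    have "\<not> e \<subseteq> g ` I" if "e \<in> E" for e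
    proof
      assume "e \<subseteq> g ` I"
      then obtain d where d: "d \<subseteq> I" "e = g ` d"
        by (auto simp: subset_image_iff)
      have "inj_on g d" using injI d(1) by (rule inj_on_subset)
      moreover have "e \<in> [V]\<^bsup>k\<^esup>" using E that by (auto simp: kgraph_def)
      ultimately have "d \<in> F"
        using d that 2(1) by (auto simp: F_def nsets_def card_image finite_image_iff)
      with 2 d show False by blast
    qed
    moreover have "g ` I \<subseteq> V" "card (g ` I) = n"
      using 2 im card_image[OF injI] by auto
    ultimately show ?thesis unfolding independent_set_def by blast
  qed
qed

lemma ramsey_property_exists:
  "\<exists>N. \<forall>V :: nat set. finite V \<and> card V = N \<longrightarrow> ramsey_property k s n V"
proof -
  obtain N :: nat where N: "partn_lst {..<N} [s, n] k"
    using ramsey2_full by blast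
  have "ramsey_property k s n {..<N}"
    unfolding ramsey_property_def
  proof (intro allI impI)
    fix E :: "nat set set" assume E: "kgraph k {..<N} E"
    define f where "f e = (if e \<in> E then 0 else 1 :: nat)" for e
    have "f \<in> [{..<N}]\<^bsup>k\<^esup> \<rightarrow> {..<2}" by (auto simp: f_def)
    then obtain i H where i: "i < length [s, n]" and H: "H \<in> [{..<N}]\<^bsup>([s, n] ! i)\<^esup>"
      and fH: "f ` [H]\<^bsup>k\<^esup> \<subseteq> {i}"
      by (rule partn_lstE[OF N]) auto
    show "contains_complete k s {..<N} E \<or> (\<exists>I. independent_set {..<N} E I \<and> card I = n)"
    proof (cases "i = 0")
      case True
      then have "[H]\<^bsup>k\<^esup> \<subseteq> E" using fH by (auto simp: f_def split: if_splits)
      with H True show ?thesis unfolding contains_complete_def by auto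
    next
      case False
      with i have i1: "i = 1" by auto
      have "\<not> e \<subseteq> H" if "e \<in> E" for e
      proof
        assume "e \<subseteq> H"
        then have "e \<in> [H]\<^bsup>k\<^esup>" using E that by (auto simp: kgraph_def nsets_def)
        then show False using fH i1 that by (auto simp: f_def)
      qed
      with H i1 have "independent_set {..<N} E H" "card H = n"
        by (auto simp: independent_set_def nsets_def)
      then show ?thesis by blast
    qed
  qed
  moreover have "\<exists>g. bij_betw g {..<N} V" if "finite V" "card V = N" for V :: "nat set"
    using that by (intro finite_same_card_bij) auto
  ultimately show ?thesis using ramsey_property_transfer by metis
qed

lemma ramsey_number_attained:
  fixes V :: "'a set"
  assumes "finite V" "card V = ramsey_number k s n"
  shows "ramsey_property k s n V"
proof -
  have "ramsey_property k s n {..<ramsey_number k s n}"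
    using LeastI_ex[OF ramsey_property_exists[of k s n]]
    unfolding ramsey_number_def[symmetric] by simp
  moreover obtain g where "bij_betw g {..<ramsey_number k s n} V"
    using assms finite_same_card_bij[of "{..<ramsey_number k s n}" V] by auto
  ultimately show ?thesis by (rule ramsey_property_transfer)
qed

end

theory Submission
  imports Defs
begin

text \<open>
  This is a stepping-up construction. Vertices are the integers below \<open>2 ^ N\<close>, where \<open>N = 2 ^ k\<close>; they
  are the leaves of a binary tree, and two of them split at level \<open>delta u v\<close>, their highest
  differing bit. Take a random two-colouring \<open>\<phi>\<close> of the pairs of levels. For a quadruple that splits
  two against two at level \<open>p\<close>, with lower splits \<open>x\<close> on the left and \<open>y\<close> on the right, colour it
  red unless \<open>\<phi> p x = 0\<close> and \<open>\<phi> p y = 1\<close>; for a quadruple peeled off at levels \<open>p > q > r\<close>,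
  colour it red for the pattern \<open>010\<close> of \<open>\<phi>\<close> on \<open>pq, pr, qr\<close> if the two turns are equal, for \<open>001\<close>
  if they are left-right, and for \<open>110\<close> if they are right-left.

  In a red clique neither side of the top split has four vertices, and in a three-against-three
  split both sides force a colour that makes some two-against-two quadruple blue; so there is no
  red clique on six vertices.

  In a blue set, a node with at least two vertices on both sides has colour 0 towards everything on
  its left and 1 towards everything on its right. The patterns \<open>001\<close> and \<open>110\<close> then forbid another
  such node below it. Hence the tree is a path followed by at most one branching into two paths,
  and a constant proportion of the set is a comb, on which \<open>delta\<close> is monotone. A comb of size
  linear in \<open>k\<close> contains the pattern \<open>010\<close>, by the union bound for \<open>\<phi>\<close>.\<close>

section \<open>Highest differing bits\<close>

text \<open>For \<open>u \<noteq> v\<close> this is the highest bit position where they differ; for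
  \<open>u = v\<close> it takes the default value 0.\<close>

definition delta :: "nat \<Rightarrow> nat \<Rightarrow> nat" where
  "delta u v = (LEAST k. u div 2 ^ Suc k = v div 2 ^ Suc k)"

text \<open>Prefixes that agree still agree after further truncation, and
  \<open>u \<noteq> v\<close> rules out \<open>j = 0\<close>. Levels can thus be handled through
  \<open>div\<close>, which is monotone.\<close>

lemma delta_less_iff:
  assumes "u \<noteq> v"
  shows "delta u v < j \<longleftrightarrow> u div 2 ^ j = v div 2 ^ j"
proof -
  let ?P = "\<lambda>k. u div 2 ^ Suc k = v div 2 ^ Suc k"
  have "u < 2 ^ Suc (u + v)" "v < 2 ^ Suc (u + v)"
    by (rule less_le_trans[OF less_exp power_increasing]; simp)+
  then have "?P (u + v)" by (metis div_less)
  then have P: "?P (delta u v)" unfolding delta_def by (rule LeastI)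
  show ?thesis
  proof
    assume "delta u v < j"
    then obtain d where "j = Suc (delta u v) + d" by (metis less_iff_Suc_add add_Suc)
    then have "x div 2 ^ j = x div 2 ^ Suc (delta u v) div 2 ^ d" for x :: nat
      by (simp only: power_add div_mult2_eq)
    with P show "u div 2 ^ j = v div 2 ^ j" by simp
  next
    assume eq: "u div 2 ^ j = v div 2 ^ j"
    with assms have "j \<noteq> 0" by (cases j) auto
    then obtain i where i: "j = Suc i" by (cases j) auto
    with eq have "delta u v \<le> i" unfolding delta_def by (intro Least_le) simp
    with i show "delta u v < j" by simp
  qed
qed

text \<open>The prefixes of \<open>u\<close>, \<open>v\<close>, \<open>w\<close> are sorted, so the
  outer two agree exactly when all three do; hence both sides have the same strict upper
  bounds.\<close>

lemma delta_max:
  assumes "u < v" "v < w"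
  shows "delta u w = max (delta u v) (delta v w)"
proof -
  have "delta u w < j \<longleftrightarrow> delta u v < j \<and> delta v w < j" for j
  proof -
    have "u div 2 ^ j \<le> v div 2 ^ j" "v div 2 ^ j \<le> w div 2 ^ j"
      using assms by (auto intro: div_le_mono)
    then show ?thesis using assms by (auto simp: delta_less_iff)
  qed
  then show ?thesis by (metis max_less_iff_conj less_irrefl linorder_less_linear)
qed

text \<open>A common level \<open>j\<close> would give three distinct numbers
  \<open>x div 2 ^ j\<close> with the same half, but only two numbers share a half.\<close>

lemma delta_neq:
  assumes "u < v" "v < w"
  shows "delta u v \<noteq> delta v w"
proof
  assume eq: "delta u v = delta v w"
  define j where "j = delta u v"
  have ne: "u div 2 ^ j \<noteq> v div 2 ^ j" "v div 2 ^ j \<noteq> w div 2 ^ j"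
    using assms eq delta_less_iff[of u v j] delta_less_iff[of v w j] by (auto simp: j_def)
  have le: "u div 2 ^ j \<le> v div 2 ^ j" "v div 2 ^ j \<le> w div 2 ^ j"
    using assms by (auto intro: div_le_mono)
  have "u div 2 ^ Suc j = v div 2 ^ Suc j" "v div 2 ^ Suc j = w div 2 ^ Suc j"
    using assms eq delta_less_iff[of u v "Suc j"] delta_less_iff[of v w "Suc j"]
    by (auto simp: j_def)
  moreover have "x div 2 ^ Suc j = x div 2 ^ j div 2" for x :: nat
    by (simp only: power_Suc2 div_mult2_eq)
  ultimately show False using ne le by simp
qed

lemma delta_less:
  assumes "u < v" "v < 2 ^ N"
  shows "delta u v < N"
  using assms by (simp add: delta_less_iff)

section \<open>The root of the binary tree spanned by a finite set\<close>

definition top_split :: "nat set \<Rightarrow> nat set \<Rightarrow> nat \<Rightarrow> bool" where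
  "top_split A B p \<longleftrightarrow>
     (\<forall>a\<in>A. \<forall>b\<in>B. a < b \<and> delta a b = p) \<and>
     (\<forall>a\<in>A. \<forall>b\<in>A. a < b \<longrightarrow> delta a b < p) \<and>
     (\<forall>a\<in>B. \<forall>b\<in>B. a < b \<longrightarrow> delta a b < p)"

lemma top_splitD:
  assumes "top_split A B p"
  shows "a \<in> A \<Longrightarrow> b \<in> B \<Longrightarrow> a < b \<and> delta a b = p"
    and "a \<in> A \<Longrightarrow> b \<in> A \<Longrightarrow> a < b \<Longrightarrow> delta a b < p"
    and "a \<in> B \<Longrightarrow> b \<in> B \<Longrightarrow> a < b \<Longrightarrow> delta a b < p"
  using assms by (auto simp: top_split_def)

lemma top_split_exists:
  fixes S :: "nat set"
  assumes "finite S" "card S \<ge> 2"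
  obtains A B p where "S = A \<union> B" "A \<noteq> {}" "B \<noteq> {}" "top_split A B p"
proof -
  have ne: "S \<noteq> {}" using assms by auto
  define u where "u = Min S"
  define w where "w = Max S"
  have uw: "u \<in> S" "w \<in> S" "\<And>x. x \<in> S \<Longrightarrow> u \<le> x \<and> x \<le> w"
    using assms ne by (auto simp: u_def w_def)
  have "u \<noteq> w"
  proof
    assume "u = w"
    with uw(3) have "S \<subseteq> {u}" by (auto dest: antisym)
    then have "card S \<le> card {u}" by (intro card_mono) auto
    with assms show False by simp
  qed
  with uw have "u < w" by fastforce
  define p where "p = delta u w"
  \<comment> \<open>The case \<open>x = u\<close> is listed separately because
    \<open>delta u u\<close> is 0, which is not below \<open>p\<close> when
    \<open>p = 0\<close>.\<close>
  define A where "A = {x \<in> S. x = u \<or> delta u x < p}"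
  have le: "delta u x \<le> p" if "x \<in> S" "x \<noteq> u" for x
    using delta_max[of u x w] uw(3)[OF that(1)] that(2)
    by (cases "x = w") (auto simp: p_def)
  have B: "delta u x = p" "u < x" if "x \<in> S - A" for x
    using le[of x] uw(3)[of x] uw(1) that by (force simp: A_def)+
  have cross: "a < b \<and> delta a b = p" if ab: "a \<in> A" "b \<in> S - A" for a b
  proof (cases "a = u")
    case True then show ?thesis using B[OF ab(2)] by simp
  next
    case False
    then have a: "u < a" "delta u a < p" using ab uw(3)[of a] by (auto simp: A_def)
    have "a < b"
    proof (rule ccontr)
      assume "\<not> a < b"
      then have "b < a" using ab by (cases "a = b") auto
      then show False using delta_max[of u b a] B[OF ab(2)] a by simp
    qed
    then show ?thesis using delta_max[of u a b] a B[OF ab(2)] by (simp add: max_def split: if_splits)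
  qed
  have left: "delta a b < p" if ab: "a \<in> A" "b \<in> A" "a < b" for a b
  proof -
    have "u < b" using ab uw(3)[of a] by (auto simp: A_def)
    then have "delta u b < p" using ab by (auto simp: A_def)
    then show "delta a b < p"
      using ab delta_max[of u a b] uw(3)[of a] by (cases "a = u") (auto simp: A_def)
  qed
  \<comment> \<open>Both elements split from \<open>u\<close> at \<open>p\<close>, so
    \<open>delta_max\<close> bounds \<open>delta a b\<close> by \<open>p\<close>, and
    \<open>delta_neq\<close> excludes equality.\<close>
  have right: "delta a b < p" if ab: "a \<in> S - A" "b \<in> S - A" "a < b" for a b
    using delta_max[of u a b] delta_neq[of u a b] B[OF ab(1)] B[OF ab(2)] ab by simp
  show ?thesis
  proof
    show "S = A \<union> (S - A)" "A \<noteq> {}" using uw by (auto simp: A_def)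
    show "S - A \<noteq> {}" using uw \<open>u < w\<close> by (auto simp: A_def p_def)
    show "top_split A (S - A) p"
      unfolding top_split_def using cross left right by blast
  qed
qed

section \<open>The colouring of quadruples\<close>

definition pat :: "(nat \<Rightarrow> nat \<Rightarrow> bool) \<Rightarrow> nat \<Rightarrow> nat \<Rightarrow> nat \<Rightarrow> bool" where
  "pat \<phi> p q r \<longleftrightarrow> \<not> \<phi> p q \<and> \<phi> p r \<and> \<not> \<phi> q r"

definition has_pat :: "(nat \<Rightarrow> nat \<Rightarrow> bool) \<Rightarrow> nat set \<Rightarrow> bool" where
  "has_pat \<phi> D \<longleftrightarrow> (\<exists>p\<in>D. \<exists>q\<in>D. \<exists>r\<in>D. r < q \<and> q < p \<and> pat \<phi> p q r)"

text \<open>Here \<open>a\<close>, \<open>b\<close>, \<open>c\<close> are the three consecutive split levels of a sorted quadruple. In the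
  last two cases the levels are \<open>p > q > r\<close> with \<open>q\<close> on side \<open>d\<close> of \<open>p\<close> and \<open>r\<close> on the other
  side \<open>d'\<close> of \<open>q\<close> (left is \<open>False\<close>, right is \<open>True\<close>), and the quadruple is red iff
  \<open>\<phi> p q = \<phi> p r = d\<close> and \<open>\<phi> q r = d'\<close>. The values of \<open>red\<close> when \<open>a = b\<close> or \<open>b = c\<close> are junk;
  by \<open>delta_neq\<close> they are never used.\<close>

definition red :: "(nat \<Rightarrow> nat \<Rightarrow> bool) \<Rightarrow> nat \<Rightarrow> nat \<Rightarrow> nat \<Rightarrow> bool" where
  "red \<phi> a b c \<longleftrightarrow>
     (if a < b then if b < c then pat \<phi> c b a else \<phi> b a \<or> \<not> \<phi> b c
      else if c < b then pat \<phi> a b c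
      else if c < a then \<phi> a c \<and> \<phi> a b \<and> \<not> \<phi> c b
      else \<not> \<phi> c a \<and> \<not> \<phi> c b \<and> \<phi> a b)"

definition red4 :: "(nat \<Rightarrow> nat \<Rightarrow> bool) \<Rightarrow> nat \<Rightarrow> nat \<Rightarrow> nat \<Rightarrow> nat \<Rightarrow> bool" where
  "red4 \<phi> u v w x \<longleftrightarrow> red \<phi> (delta u v) (delta v w) (delta w x)"

section \<open>No red clique on six vertices\<close>

text \<open>Five vertices, the first alone on its side of the top level \<open>a\<close>. Some pair
  of levels would need both colours: \<open>b\<close> and \<open>d\<close> if \<open>b\<close>,
  \<open>c\<close>, \<open>d\<close> is monotone, \<open>a\<close> and \<open>c\<close> if
  \<open>c\<close> is largest, and if \<open>c\<close> is smallest, \<open>a\<close> and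
  \<open>b\<close> or \<open>b\<close> and \<open>d\<close> according as \<open>b < d\<close> or
  \<open>d < b\<close>.\<close>

lemma no_red_split_first:
  assumes "b < a" "c < a" "d < a" "b \<noteq> c" "c \<noteq> d" "max b c \<noteq> d"
    and "red \<phi> b c d" "red \<phi> a c d" "red \<phi> a (max b c) d" "red \<phi> a b (max c d)" "red \<phi> a b c"
  shows False
  using assms
  by (cases "b < c"; cases "c < d"; cases "b < d") (auto simp: red_def pat_def max_def split: if_splits)

text \<open>Here the last vertex is alone. The conflict is at \<open>b\<close> and \<open>d\<close>
  for \<open>b < c < d\<close>, at \<open>b\<close> and \<open>c\<close> for
  \<open>b > c > d\<close>, and at \<open>a\<close> and \<open>c\<close> if \<open>c\<close> is
  smallest. If \<open>c\<close> is largest, \<open>\<phi> c b\<close> is forced to be false and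
  \<open>\<phi> c d\<close> true, which makes \<open>b\<close>, \<open>c\<close>, \<open>d\<close>
  blue.\<close>

lemma no_red_split_last:
  assumes "b < a" "c < a" "d < a" "b \<noteq> c" "c \<noteq> d" "max b c \<noteq> d"
    and "red \<phi> b c d" "red \<phi> b c a" "red \<phi> b (max c d) a" "red \<phi> (max b c) d a" "red \<phi> c d a"
  shows False
  using assms
  by (cases "b < c"; cases "c < d"; cases "b < d") (auto simp: red_def pat_def max_def split: if_splits)

text \<open>In either order of \<open>a\<close> and \<open>b\<close> the left triple forces
  \<open>\<phi> p b\<close> to be false, and in either order of \<open>c\<close> and
  \<open>d\<close> the right triple forces \<open>\<phi> p d\<close> to be true; then the quadruple
  with levels \<open>b\<close>, \<open>p\<close>, \<open>d\<close> is blue.\<close>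

lemma no_red_split_middle:
  assumes "a < p" "b < p" "c < p" "d < p" "a \<noteq> b" "c \<noteq> d"
    and "red \<phi> a b p" "red \<phi> p c d"
    and "red \<phi> a p c" "red \<phi> a p d" "red \<phi> b p c" "red \<phi> b p d"
  shows False
  using assms
  by (cases "a < b"; cases "c < d") (auto simp: red_def pat_def)

lemma strict_mono_enumeration:
  fixes S :: "nat set"
  assumes "finite S" "m \<le> card S"
  obtains e :: "nat \<Rightarrow> nat" where "\<And>i. i < m \<Longrightarrow> e i \<in> S" "\<And>i j. i < j \<Longrightarrow> j < m \<Longrightarrow> e i < e j"
proof
  let ?xs = "sorted_list_of_set S"
  show "?xs ! i \<in> S" if "i < m" for i
    using assms that nth_mem[of i ?xs] by simp
  show "?xs ! i < ?xs ! j" if "i < j" "j < m" for i j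
    using assms that strict_sorted_list_of_set[of S] by (auto simp: sorted_wrt_iff_nth_less)
qed

text \<open>The top split leaves four vertices on one side, with a fifth from the nonempty other
  side, or three on each side.\<close>

lemma no_red_K6:
  fixes S :: "nat set"
  assumes fin: "finite S" and card: "card S = 6"
    and red: "\<And>u v w x. {u, v, w, x} \<subseteq> S \<Longrightarrow> u < v \<Longrightarrow> v < w \<Longrightarrow> w < x \<Longrightarrow> red4 \<phi> u v w x"
  shows False
proof -
  have "2 \<le> card S" using card by simp
  then obtain A B p where split: "S = A \<union> B" "A \<noteq> {}" "B \<noteq> {}" and top: "top_split A B p"
    using top_split_exists[OF fin] by metis
  have fAB: "finite A" "finite B" using fin split(1) by auto
  have cAB: "6 \<le> card A + card B" using card split(1) card_Un_le[of A B] by simp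
  consider "4 \<le> card A" | "4 \<le> card B" | "3 \<le> card A" "3 \<le> card B" using cAB by linarith
  then show False
  proof cases
    case 1
    then obtain e :: "nat \<Rightarrow> nat" where e: "\<And>i. i < 4 \<Longrightarrow> e i \<in> A" "\<And>i j. i < j \<Longrightarrow> j < 4 \<Longrightarrow> e i < e j"
      using strict_mono_enumeration[OF fAB(1), of 4] by metis
    obtain b where b: "b \<in> B" using split by blast
    have eA: "e 0 \<in> A" "e 1 \<in> A" "e 2 \<in> A" "e 3 \<in> A" using e(1) by auto
    have lt: "e 0 < e 1" "e 1 < e 2" "e 2 < e 3" using e(2) by auto
    have lt': "e 0 < e 2" "e 1 < e 3" using lt by auto
    have S: "e 0 \<in> S" "e 1 \<in> S" "e 2 \<in> S" "e 3 \<in> S" "b \<in> S" using eA b split(1) by auto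
    \<comment> \<open>Leaving out an inner vertex replaces the two levels next to it by their
      maximum.\<close>
    have mx: "delta (e 0) (e 2) = max (delta (e 0) (e 1)) (delta (e 1) (e 2))"
      "delta (e 1) (e 3) = max (delta (e 1) (e 2)) (delta (e 2) (e 3))"
      using lt by (auto intro: delta_max)
    have p: "e i < b" "delta (e i) b = p" if "e i \<in> A" for i using top_splitD(1)[OF top that b] by auto
    show False
    proof (rule no_red_split_last)
      show "delta (e 0) (e 1) < p" "delta (e 1) (e 2) < p" "delta (e 2) (e 3) < p"
        using top_splitD(2)[OF top] eA lt by auto
      show "delta (e 0) (e 1) \<noteq> delta (e 1) (e 2)" "delta (e 1) (e 2) \<noteq> delta (e 2) (e 3)"
        "max (delta (e 0) (e 1)) (delta (e 1) (e 2)) \<noteq> delta (e 2) (e 3)"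
        using delta_neq lt lt' mx by metis+
      show "red \<phi> (delta (e 0) (e 1)) (delta (e 1) (e 2)) (delta (e 2) (e 3))"
        using red[of "e 0" "e 1" "e 2" "e 3"] S lt by (simp add: red4_def)
      show "red \<phi> (delta (e 0) (e 1)) (delta (e 1) (e 2)) p"
        using red[of "e 0" "e 1" "e 2" b] S lt p eA by (simp add: red4_def)
      show "red \<phi> (delta (e 0) (e 1)) (max (delta (e 1) (e 2)) (delta (e 2) (e 3))) p"
        using red[of "e 0" "e 1" "e 3" b] S lt lt' p eA mx by (simp add: red4_def)
      show "red \<phi> (max (delta (e 0) (e 1)) (delta (e 1) (e 2))) (delta (e 2) (e 3)) p"
        using red[of "e 0" "e 2" "e 3" b] S lt lt' p eA mx by (simp add: red4_def)
      show "red \<phi> (delta (e 1) (e 2)) (delta (e 2) (e 3)) p"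
        using red[of "e 1" "e 2" "e 3" b] S lt p eA by (simp add: red4_def)
    qed
  next
    case 2
    then obtain e :: "nat \<Rightarrow> nat" where e: "\<And>i. i < 4 \<Longrightarrow> e i \<in> B" "\<And>i j. i < j \<Longrightarrow> j < 4 \<Longrightarrow> e i < e j"
      using strict_mono_enumeration[OF fAB(2), of 4] by metis
    obtain a where a: "a \<in> A" using split by blast
    have eB: "e 0 \<in> B" "e 1 \<in> B" "e 2 \<in> B" "e 3 \<in> B" using e(1) by auto
    have lt: "e 0 < e 1" "e 1 < e 2" "e 2 < e 3" using e(2) by auto
    have lt': "e 0 < e 2" "e 1 < e 3" using lt by auto
    have S: "e 0 \<in> S" "e 1 \<in> S" "e 2 \<in> S" "e 3 \<in> S" "a \<in> S" using eB a split(1) by auto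
    have mx: "delta (e 0) (e 2) = max (delta (e 0) (e 1)) (delta (e 1) (e 2))"
      "delta (e 1) (e 3) = max (delta (e 1) (e 2)) (delta (e 2) (e 3))"
      using lt by (auto intro: delta_max)
    have p: "a < e i" "delta a (e i) = p" if "e i \<in> B" for i using top_splitD(1)[OF top a that] by auto
    show False
    proof (rule no_red_split_first)
      show "delta (e 0) (e 1) < p" "delta (e 1) (e 2) < p" "delta (e 2) (e 3) < p"
        using top_splitD(3)[OF top] eB lt by auto
      show "delta (e 0) (e 1) \<noteq> delta (e 1) (e 2)" "delta (e 1) (e 2) \<noteq> delta (e 2) (e 3)"
        "max (delta (e 0) (e 1)) (delta (e 1) (e 2)) \<noteq> delta (e 2) (e 3)"
        using delta_neq lt lt' mx by metis+
      show "red \<phi> (delta (e 0) (e 1)) (delta (e 1) (e 2)) (delta (e 2) (e 3))"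
        using red[of "e 0" "e 1" "e 2" "e 3"] S lt by (simp add: red4_def)
      show "red \<phi> p (delta (e 1) (e 2)) (delta (e 2) (e 3))"
        using red[of a "e 1" "e 2" "e 3"] S lt p eB by (simp add: red4_def)
      show "red \<phi> p (max (delta (e 0) (e 1)) (delta (e 1) (e 2))) (delta (e 2) (e 3))"
        using red[of a "e 0" "e 2" "e 3"] S lt lt' p eB mx by (simp add: red4_def)
      show "red \<phi> p (delta (e 0) (e 1)) (max (delta (e 1) (e 2)) (delta (e 2) (e 3)))"
        using red[of a "e 0" "e 1" "e 3"] S lt lt' p eB mx by (simp add: red4_def)
      show "red \<phi> p (delta (e 0) (e 1)) (delta (e 1) (e 2))"
        using red[of a "e 0" "e 1" "e 2"] S lt p eB by (simp add: red4_def)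
    qed
  next
    case 3
    obtain e :: "nat \<Rightarrow> nat" where e: "\<And>i. i < 3 \<Longrightarrow> e i \<in> A" "\<And>i j. i < j \<Longrightarrow> j < 3 \<Longrightarrow> e i < e j"
      using strict_mono_enumeration[OF fAB(1) 3(1)] by metis
    obtain f :: "nat \<Rightarrow> nat" where f: "\<And>i. i < 3 \<Longrightarrow> f i \<in> B" "\<And>i j. i < j \<Longrightarrow> j < 3 \<Longrightarrow> f i < f j"
      using strict_mono_enumeration[OF fAB(2) 3(2)] by metis
    have eA: "e 0 \<in> A" "e 1 \<in> A" "e 2 \<in> A" using e(1) by auto
    have fB: "f 0 \<in> B" "f 1 \<in> B" "f 2 \<in> B" using f(1) by auto
    have lt: "e 0 < e 1" "e 1 < e 2" "f 0 < f 1" "f 1 < f 2" using e(2) f(2) by auto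
    have S: "e 0 \<in> S" "e 1 \<in> S" "e 2 \<in> S" "f 0 \<in> S" "f 1 \<in> S" "f 2 \<in> S"
      using eA fB split(1) by auto
    have p: "e i < f j" "delta (e i) (f j) = p" if "e i \<in> A" "f j \<in> B" for i j
      using top_splitD(1)[OF top that] by auto
    note facts = p eA fB S lt
    show False
    proof (rule no_red_split_middle)
      show "delta (e 0) (e 1) < p" "delta (e 1) (e 2) < p" "delta (f 0) (f 1) < p" "delta (f 1) (f 2) < p"
        using top_splitD(2,3)[OF top] eA fB lt by auto
      show "delta (e 0) (e 1) \<noteq> delta (e 1) (e 2)" "delta (f 0) (f 1) \<noteq> delta (f 1) (f 2)"
        using delta_neq lt by auto
      show "red \<phi> (delta (e 0) (e 1)) (delta (e 1) (e 2)) p"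
        using red[of "e 0" "e 1" "e 2" "f 0"] facts by (simp add: red4_def)
      show "red \<phi> p (delta (f 0) (f 1)) (delta (f 1) (f 2))"
        using red[of "e 0" "f 0" "f 1" "f 2"] facts by (simp add: red4_def)
      show "red \<phi> (delta (e 0) (e 1)) p (delta (f 0) (f 1))"
        using red[of "e 0" "e 1" "f 0" "f 1"] facts by (simp add: red4_def)
      show "red \<phi> (delta (e 0) (e 1)) p (delta (f 1) (f 2))"
        using red[of "e 0" "e 1" "f 1" "f 2"] facts by (simp add: red4_def)
      show "red \<phi> (delta (e 1) (e 2)) p (delta (f 0) (f 1))"
        using red[of "e 1" "e 2" "f 0" "f 1"] facts by (simp add: red4_def)
      show "red \<phi> (delta (e 1) (e 2)) p (delta (f 1) (f 2))"
        using red[of "e 1" "e 2" "f 1" "f 2"] facts by (simp add: red4_def)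
    qed
  qed
qed

section \<open>Combs and the shape of blue sets\<close>

text \<open>A comb: every split of the tree on \<open>T\<close> has a single vertex on its right.
  For \<open>delta_dec\<close> it is on the left.\<close>

definition delta_inc :: "nat set \<Rightarrow> bool" where
  "delta_inc T \<longleftrightarrow> (\<forall>a\<in>T. \<forall>b\<in>T. \<forall>c\<in>T. a < b \<longrightarrow> b < c \<longrightarrow> delta a b < delta b c)"

definition delta_dec :: "nat set \<Rightarrow> bool" where
  "delta_dec T \<longleftrightarrow> (\<forall>a\<in>T. \<forall>b\<in>T. \<forall>c\<in>T. a < b \<longrightarrow> b < c \<longrightarrow> delta b c < delta a b)"

lemma delta_inc_insert:
  assumes "delta_inc T" "\<And>a. a \<in> T \<Longrightarrow> a < w \<and> delta a w = p"
    and "\<And>a b. a \<in> T \<Longrightarrow> b \<in> T \<Longrightarrow> a < b \<Longrightarrow> delta a b < p"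
  shows "delta_inc (insert w T)"
  using assms unfolding delta_inc_def by (metis insert_iff less_asym)

lemma delta_dec_insert:
  assumes "delta_dec T" "\<And>a. a \<in> T \<Longrightarrow> w < a \<and> delta w a = p"
    and "\<And>a b. a \<in> T \<Longrightarrow> b \<in> T \<Longrightarrow> a < b \<Longrightarrow> delta a b < p"
  shows "delta_dec (insert w T)"
  using assms unfolding delta_dec_def by (metis insert_iff less_asym)

text \<open>Used with \<open>k = 1\<close> for sets without branching and with \<open>k = 2\<close> for blue sets: the common step is
  to peel off a vertex that is alone on one side of the top split.\<close>

lemma combs_by_splitting:
  fixes S :: "nat set"
  assumes "finite S" "S \<noteq> {}" "P S" "k > 0"
    and mono: "\<And>S T. P S \<Longrightarrow> T \<subseteq> S \<Longrightarrow> P T"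
    and branch: "\<And>S A B p. finite S \<Longrightarrow> P S \<Longrightarrow> S = A \<union> B \<Longrightarrow> top_split A B p \<Longrightarrow>
      card A \<ge> 2 \<Longrightarrow> card B \<ge> 2 \<Longrightarrow>
      \<exists>I D. I \<subseteq> S \<and> D \<subseteq> S \<and> delta_inc I \<and> delta_dec D \<and> card S \<le> k * (card I + card D)"
  shows "\<exists>I D. I \<subseteq> S \<and> D \<subseteq> S \<and> delta_inc I \<and> delta_dec D \<and> card S \<le> k * (card I + card D)"
  using assms(1-3)
proof (induction S rule: finite_psubset_induct)
  case (psubset S)
  show ?case
  proof (cases "card S \<ge> 2")
    case False
    then have "card S = 1"
      using psubset by (metis One_nat_def Suc_1 card_0_eq le_SucE le_zero_eq not_less_eq_eq)
    then obtain x where "S = {x}" by (auto simp: card_1_singleton_iff)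
    then show ?thesis using \<open>k > 0\<close>
      by (intro exI[of _ S]) (auto simp: delta_inc_def delta_dec_def)
  next
    case True
    obtain A B p where split: "S = A \<union> B" "A \<noteq> {}" "B \<noteq> {}" and top: "top_split A B p"
      using top_split_exists[OF psubset.hyps True] by metis
    have fin: "finite A" "finite B" using split(1) psubset.hyps by auto
    have disj: "A \<inter> B = {}" using top_splitD(1)[OF top] by blast
    have sub: "A \<subset> S" "B \<subset> S" using split(1-3) disj by auto
    have PAB: "P A" "P B" using mono psubset.prems sub by blast+
    have cS: "card S = card A + card B" using split(1) fin disj by (simp add: card_Un_disjoint)
    consider "card A = 1" | "card B = 1" | "card A \<ge> 2" "card B \<ge> 2"
      using split(2,3) fin by (metis One_nat_def Suc_1 Suc_leI card_gt_0_iff le_neq_implies_less)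
    then show ?thesis
    proof cases
      case 1
      then obtain w where w: "A = {w}" by (auto simp: card_1_singleton_iff)
      obtain I D where ID: "I \<subseteq> B" "D \<subseteq> B" "delta_inc I" "delta_dec D"
        "card B \<le> k * (card I + card D)"
        using psubset.IH[OF sub(2) split(3) PAB(2)] by blast
      \<comment> \<open>A vertex alone on the left extends only the decreasing comb, but the sum of
        the two sizes still grows by one; this is why the bound uses the sum.\<close>
      have "delta_dec (insert w D)"
      proof (rule delta_dec_insert)
        show "w < a \<and> delta w a = p" if "a \<in> D" for a
          using top_splitD(1)[OF top, of w a] that ID(2) w by auto
        show "delta a b < p" if "a \<in> D" "b \<in> D" "a < b" for a b
          using top_splitD(3)[OF top, of a b] that ID(2) by auto
      qed (fact ID)
      moreover have "w \<notin> D" using ID(2) disj w by auto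
      then have "card (insert w D) = Suc (card D)" using ID(2) fin by (simp add: finite_subset)
      then have "card S \<le> k * (card I + card (insert w D))"
        using ID(5) cS w \<open>k > 0\<close> by simp
      moreover have "I \<subseteq> S" "insert w D \<subseteq> S" using ID(1,2) w split(1) by auto
      ultimately show ?thesis using ID(3) by blast
    next
      case 2
      then obtain w where w: "B = {w}" by (auto simp: card_1_singleton_iff)
      obtain I D where ID: "I \<subseteq> A" "D \<subseteq> A" "delta_inc I" "delta_dec D"
        "card A \<le> k * (card I + card D)"
        using psubset.IH[OF sub(1) split(2) PAB(1)] by blast
      have "delta_inc (insert w I)"
      proof (rule delta_inc_insert)
        show "a < w \<and> delta a w = p" if "a \<in> I" for a
          using top_splitD(1)[OF top, of a w] that ID(1) w by auto
        show "delta a b < p" if "a \<in> I" "b \<in> I" "a < b" for a b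
          using top_splitD(2)[OF top, of a b] that ID(1) by auto
      qed (fact ID)
      moreover have "w \<notin> I" using ID(1) disj w by auto
      then have "card (insert w I) = Suc (card I)" using ID(1) fin by (simp add: finite_subset)
      then have "card S \<le> k * (card (insert w I) + card D)"
        using ID(5) cS w \<open>k > 0\<close> by simp
      moreover have "D \<subseteq> S" "insert w I \<subseteq> S" using ID(1,2) w split(1) by auto
      ultimately show ?thesis using ID(4) by blast
    next
      case 3
      then show ?thesis using branch[OF psubset.hyps psubset.prems(2) split(1) top] by blast
    qed
  qed
qed

text \<open>No node of the tree has two vertices on both sides. The form with quadruples passes to
  subsets.\<close>

definition unbranched :: "nat set \<Rightarrow> bool" where
  "unbranched S \<longleftrightarrow> (\<forall>a\<in>S. \<forall>b\<in>S. \<forall>c\<in>S. \<forall>d\<in>S. a < b \<longrightarrow> b < c \<longrightarrow> c < d \<longrightarrow>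
     \<not> (delta a b < delta b c \<and> delta c d < delta b c))"

definition blue :: "(nat \<Rightarrow> nat \<Rightarrow> bool) \<Rightarrow> nat set \<Rightarrow> bool" where
  "blue \<phi> S \<longleftrightarrow> (\<forall>a\<in>S. \<forall>b\<in>S. \<forall>c\<in>S. \<forall>d\<in>S. a < b \<longrightarrow> b < c \<longrightarrow> c < d \<longrightarrow> \<not> red4 \<phi> a b c d)"

lemma unbranched_subset: "unbranched S \<Longrightarrow> T \<subseteq> S \<Longrightarrow> unbranched T"
  unfolding unbranched_def by (meson subsetD)

lemma blue_subset: "blue \<phi> S \<Longrightarrow> T \<subseteq> S \<Longrightarrow> blue \<phi> T"
  unfolding blue_def by (meson subsetD)

lemma two_elements:
  fixes A :: "nat set"
  assumes "card A \<ge> 2"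
  obtains a b where "a \<in> A" "b \<in> A" "a < b"
proof -
  obtain e :: "nat \<Rightarrow> nat" where "\<And>i. i < 2 \<Longrightarrow> e i \<in> A" "\<And>i j. i < j \<Longrightarrow> j < 2 \<Longrightarrow> e i < e j"
    using strict_mono_enumeration[of A 2] assms by (metis card.infinite not_numeral_le_zero)
  then have "e 0 \<in> A" "e 1 \<in> A" "e 0 < e 1" by auto
  then show ?thesis using that by blast
qed

text \<open>Every split peels off a single vertex, so the branching case is vacuous and nothing is
  lost.\<close>

lemma unbranched_combs:
  assumes "finite S" "S \<noteq> {}" "unbranched S"
  shows "\<exists>I D. I \<subseteq> S \<and> D \<subseteq> S \<and> delta_inc I \<and> delta_dec D \<and> card S \<le> card I + card D"
proof -
  have "\<exists>I D. I \<subseteq> S \<and> D \<subseteq> S \<and> delta_inc I \<and> delta_dec D \<and> card S \<le> 1 * (card I + card D)"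
  proof (rule combs_by_splitting[where P = unbranched])
    fix S A B p
    assume "unbranched S" and S: "S = A \<union> B" and top: "top_split A B p"
      and "card A \<ge> 2" "card B \<ge> 2"
    then obtain a a' b b' where "a \<in> A" "a' \<in> A" "a < a'" "b \<in> B" "b' \<in> B" "b < b'"
      by (metis two_elements)
    then have False using \<open>unbranched S\<close> S top_splitD[OF top] unfolding unbranched_def by (metis UnCI)
    then show "\<exists>I D. I \<subseteq> S \<and> D \<subseteq> S \<and> delta_inc I \<and> delta_dec D \<and> card S \<le> 1 * (card I + card D)" ..
  qed (use assms unbranched_subset in auto)
  then show ?thesis by simp
qed

text \<open>Combining a pair from \<open>A\<close> with a pair from \<open>B\<close> shows that
  \<open>\<phi> p\<close> is false on all levels inside \<open>A\<close> and true on all levels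
  inside \<open>B\<close>. A second branching on either side then creates a red quadruple.\<close>

lemma blue_split_unbranched:
  assumes blue: "blue \<phi> (A \<union> B)" and top: "top_split A B p"
    and "card A \<ge> 2" "card B \<ge> 2"
  shows "unbranched A" "unbranched B"
proof -
  obtain a0 a1 b0 b1 where ab: "a0 \<in> A" "a1 \<in> A" "a0 < a1" "b0 \<in> B" "b1 \<in> B" "b0 < b1"
    using assms(3,4) by (metis two_elements)
  note sp = top_splitD[OF top]
  have nr: "\<not> red \<phi> (delta a b) (delta b c) (delta c d)"
    if "a \<in> A \<union> B" "b \<in> A \<union> B" "c \<in> A \<union> B" "d \<in> A \<union> B" "a < b" "b < c" "c < d" for a b c d
    using blue that unfolding blue_def red4_def by blast
  have left: "\<not> \<phi> p (delta a b)" if "a \<in> A" "b \<in> A" "a < b" for a b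
    using nr[of a b b0 b1] that ab sp(1)[of b b0] sp(2)[of a b] sp(3)[of b0 b1] by (auto simp: red_def)
  have right: "\<phi> p (delta a b)" if "a \<in> B" "b \<in> B" "a < b" for a b
    using nr[of a0 a1 a b] that ab sp(1)[of a1 a] sp(2)[of a0 a1] sp(3)[of a b] by (auto simp: red_def)
  show "unbranched A" unfolding unbranched_def
  proof (intro ballI impI notI)
    fix a b c d assume m: "a \<in> A" "b \<in> A" "c \<in> A" "d \<in> A" "a < b" "b < c" "c < d"
      and "delta a b < delta b c \<and> delta c d < delta b c"
    \<comment> \<open>With \<open>q = delta b c\<close> and \<open>r = delta c d\<close>, blueness
      of \<open>a\<close>, \<open>b\<close>, \<open>c\<close>, \<open>d\<close> gives
      \<open>\<phi> q r\<close>; so \<open>b\<close>, \<open>c\<close>, \<open>d\<close>,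
      \<open>b0\<close> has the red pattern 001.\<close>
    then show False
      using nr[of a b c d] nr[of b c d b0] left[of b c] left[of c d] sp(1)[of d b0] sp(2)[of b c] ab
      by (auto simp: red_def)
  qed
  show "unbranched B" unfolding unbranched_def
  proof (intro ballI impI notI)
    fix a b c d assume m: "a \<in> B" "b \<in> B" "c \<in> B" "d \<in> B" "a < b" "b < c" "c < d"
      and "delta a b < delta b c \<and> delta c d < delta b c"
    \<comment> \<open>With \<open>q = delta b c\<close> and \<open>r = delta a b\<close>, blueness
      makes \<open>\<phi> q r\<close> false; so \<open>a0\<close>, \<open>a\<close>,
      \<open>b\<close>, \<open>c\<close> has the red pattern 110.\<close>
    then show False
      using nr[of a b c d] nr[of a0 a b c] right[of b c] right[of a b] sp(1)[of a0 a] sp(3)[of b c] sp(3)[of a b] ab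
      by (auto simp: red_def)
  qed
qed

lemma blue_combs:
  assumes "finite S" "S \<noteq> {}" "blue \<phi> S"
  shows "\<exists>I D. I \<subseteq> S \<and> D \<subseteq> S \<and> delta_inc I \<and> delta_dec D \<and> card S \<le> 2 * (card I + card D)"
proof (rule combs_by_splitting[where P = "blue \<phi>"])
  fix S A B p
  assume fin: "finite S" and "blue \<phi> S" and S: "S = A \<union> B" and "top_split A B p"
    and c: "card A \<ge> 2" "card B \<ge> 2"
  then have ub: "unbranched A" "unbranched B"
    using blue_split_unbranched[of \<phi> A B p] by blast+
  have ne: "finite A" "A \<noteq> {}" "finite B" "B \<noteq> {}" using fin S c by auto
  have cS: "card S \<le> card A + card B" using S card_Un_le by blast
  \<comment> \<open>Only the larger side of the first branching is kept; this costs the factor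
    2.\<close>
  define T where "T = (if card A \<le> card B then B else A)"
  have T: "finite T" "T \<noteq> {}" "unbranched T" "T \<subseteq> S" "card S \<le> 2 * card T"
    using ne ub S cS by (auto simp: T_def)
  then obtain I D where "I \<subseteq> T" "D \<subseteq> T" "delta_inc I" "delta_dec D" "card T \<le> card I + card D"
    using unbranched_combs by metis
  then show "\<exists>I D. I \<subseteq> S \<and> D \<subseteq> S \<and> delta_inc I \<and> delta_dec D \<and> card S \<le> 2 * (card I + card D)"
    using T by (intro exI[of _ I] exI[of _ D]) auto
qed (use assms blue_subset in auto)

section \<open>Blue combs are short\<close>

text \<open>A comb on \<open>m + 1\<close> vertices has \<open>m\<close> distinct split levels, and
  any three of them are the levels of a quadruple in the comb; the pattern \<open>pat\<close> makes
  one such quadruple red.\<close>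

lemma delta_inc_blue_bound:
  assumes "finite T" "T \<subseteq> {..<2 ^ N}" "delta_inc T" "blue \<phi> T"
    and pat: "\<And>D. D \<subseteq> {..<N} \<Longrightarrow> card D = m \<Longrightarrow> has_pat \<phi> D"
  shows "card T \<le> m"
proof (rule ccontr)
  assume "\<not> card T \<le> m"
  then obtain e where e: "\<And>i. i < Suc m \<Longrightarrow> e i \<in> T" "\<And>i j. i < j \<Longrightarrow> j < Suc m \<Longrightarrow> e i < e j"
    using strict_mono_enumeration[OF assms(1), of "Suc m"] by (metis not_less_eq_eq)
  \<comment> \<open>All levels are measured from the first vertex; \<open>e (Suc j)\<close> splits
    from every earlier vertex at level \<open>f j\<close>.\<close>
  define f where "f i = delta (e 0) (e (Suc i))" for i
  have f: "f i < f j" "delta (e (Suc i)) (e (Suc j)) = f j" if "i < j" "j < m" for i j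
  proof -
    have "delta (e 0) (e (Suc i)) < delta (e (Suc i)) (e (Suc j))"
      using assms(3) e that unfolding delta_inc_def by auto
    moreover have "f j = max (f i) (delta (e (Suc i)) (e (Suc j)))"
      unfolding f_def using e(2) that by (intro delta_max) auto
    ultimately show "f i < f j" "delta (e (Suc i)) (e (Suc j)) = f j" by (auto simp: f_def)
  qed
  have inj: "inj_on f {..<m}" by (rule linorder_inj_onI) (use f in force)+
  have "f ` {..<m} \<subseteq> {..<N}"
    using e assms(2) by (auto simp: f_def intro!: delta_less)
  moreover have "card (f ` {..<m}) = m" using inj by (simp add: card_image)
  ultimately obtain i j k where ijk: "i < m" "j < m" "k < m" "f k < f j" "f j < f i" "pat \<phi> (f i) (f j) (f k)"
    using pat[of "f ` {..<m}"] unfolding has_pat_def by blast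
  then have "k < j" "j < i" using f(1) by (metis less_asym linorder_neqE_nat less_irrefl)+
  then have "\<not> red4 \<phi> (e 0) (e (Suc k)) (e (Suc j)) (e (Suc i))"
    using assms(4) e ijk unfolding blue_def by simp
  moreover have "delta (e 0) (e (Suc k)) = f k" by (simp add: f_def)
  ultimately show False
    using ijk f(2)[OF \<open>k < j\<close> \<open>j < m\<close>] f(2)[OF \<open>j < i\<close> \<open>i < m\<close>] by (simp add: red4_def red_def)
qed

lemma delta_dec_blue_bound:
  assumes "finite T" "T \<subseteq> {..<2 ^ N}" "delta_dec T" "blue \<phi> T"
    and pat: "\<And>D. D \<subseteq> {..<N} \<Longrightarrow> card D = m \<Longrightarrow> has_pat \<phi> D"
  shows "card T \<le> m"
proof (rule ccontr)
  assume "\<not> card T \<le> m"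
  then obtain e where e: "\<And>i. i < Suc m \<Longrightarrow> e i \<in> T" "\<And>i j. i < j \<Longrightarrow> j < Suc m \<Longrightarrow> e i < e j"
    using strict_mono_enumeration[OF assms(1), of "Suc m"] by (metis not_less_eq_eq)
  \<comment> \<open>In the mirrored comb the levels are measured to the last vertex;
    \<open>e i\<close> splits from every later vertex at level \<open>f i\<close>.\<close>
  define f where "f i = delta (e i) (e m)" for i
  have f: "f j < f i" "delta (e i) (e j) = f i" if "i < j" "j < m" for i j
  proof -
    have "delta (e j) (e m) < delta (e i) (e j)"
      using assms(3) e that unfolding delta_dec_def by auto
    moreover have "f i = max (delta (e i) (e j)) (f j)"
      unfolding f_def using e(2) that by (intro delta_max) auto
    ultimately show "f j < f i" "delta (e i) (e j) = f i" by (auto simp: f_def)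
  qed
  have inj: "inj_on f {..<m}" by (rule linorder_inj_onI) (use f in force)+
  have "f ` {..<m} \<subseteq> {..<N}"
    using e assms(2) by (auto simp: f_def intro!: delta_less)
  moreover have "card (f ` {..<m}) = m" using inj by (simp add: card_image)
  ultimately obtain i j k where ijk: "i < m" "j < m" "k < m" "f k < f j" "f j < f i" "pat \<phi> (f i) (f j) (f k)"
    using pat[of "f ` {..<m}"] unfolding has_pat_def by blast
  then have "i < j" "j < k" using f(1) by (metis less_asym linorder_neqE_nat less_irrefl)+
  then have "\<not> red4 \<phi> (e i) (e j) (e k) (e m)"
    using assms(4) e ijk unfolding blue_def by simp
  moreover have "delta (e k) (e m) = f k" by (simp add: f_def)
  ultimately show False
    using ijk f(2)[OF \<open>i < j\<close> \<open>j < m\<close>] f(2)[OF \<open>j < k\<close> \<open>k < m\<close>] by (simp add: red4_def red_def)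
qed

section \<open>Counting colourings of pairs of levels\<close>

text \<open>Independence in counting form: on each of the disjoint blocks, 7 of the 8 traces remain,
  a factor 7/8 per block. Multiplying out keeps the inequality in the natural numbers.\<close>

lemma card_avoiding_blocks:
  fixes U :: "'a set"
  assumes "finite I" "finite U"
    and "\<And>i. i \<in> I \<Longrightarrow> T i \<subseteq> U \<and> card (T i) = 3 \<and> P i \<subseteq> T i"
    and "\<And>i j. i \<in> I \<Longrightarrow> j \<in> I \<Longrightarrow> i \<noteq> j \<Longrightarrow> T i \<inter> T j = {}"
  shows "8 ^ card I * card {F. F \<subseteq> U \<and> (\<forall>i\<in>I. F \<inter> T i \<noteq> P i)} \<le> 7 ^ card I * 2 ^ card U"
  using assms
proof (induction I arbitrary: U rule: finite_induct)
  case empty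
  then show ?case by (simp flip: Pow_def add: card_Pow)
next
  case (insert i I)
  have i: "T i \<subseteq> U" "card (T i) = 3" "P i \<subseteq> T i" using insert.prems(2)[of i] by auto
  have fT: "finite (T i)" using i by (simp add: card_ge_0_finite)
  define W where "W = U - T i"
  let ?X = "{F. F \<subseteq> U \<and> (\<forall>j\<in>insert i I. F \<inter> T j \<noteq> P j)}"
  let ?Y = "{F. F \<subseteq> W \<and> (\<forall>j\<in>I. F \<inter> T j \<noteq> P j)}"
  have cU: "card U = card W + 3"
    using i fT insert.prems(1) card_mono[of U "T i"] by (simp add: W_def card_Diff_subset)
  have disj: "T j \<inter> T i = {}" if "j \<in> I" for j
    using insert.prems(3)[of j i] insert.hyps that by auto
  have "8 ^ card I * card ?Y \<le> 7 ^ card I * 2 ^ card W"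
  proof (rule insert.IH)
    show "finite W" using insert.prems(1) by (simp add: W_def)
    show "T j \<subseteq> W \<and> card (T j) = 3 \<and> P j \<subseteq> T j" if "j \<in> I" for j
      using insert.prems(2)[of j] disj[OF that] that by (auto simp: W_def)
    show "T j \<inter> T j' = {}" if "j \<in> I" "j' \<in> I" "j \<noteq> j'" for j j'
      using insert.prems(3) that by auto
  qed
  \<comment> \<open>A set is determined by its trace on block \<open>i\<close> and its remainder
    outside it.\<close>
  moreover have "card ?X \<le> card ((Pow (T i) - {P i}) \<times> ?Y)"
  proof (rule card_inj_on_le[where f = "\<lambda>F. (F \<inter> T i, F - T i)"])
    show "inj_on (\<lambda>F. (F \<inter> T i, F - T i)) ?X" by (rule inj_onI) blast
    have "(F - T i) \<inter> T j = F \<inter> T j" if "j \<in> I" for F j using disj[OF that] by blast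
    then show "(\<lambda>F. (F \<inter> T i, F - T i)) ` ?X \<subseteq> (Pow (T i) - {P i}) \<times> ?Y"
      by (auto simp: W_def)
    show "finite ((Pow (T i) - {P i}) \<times> ?Y)"
      using fT insert.prems(1) by (auto simp: W_def)
  qed
  moreover have "card (Pow (T i) - {P i}) = 7"
    using i fT by (simp add: card_Pow)
  ultimately have X: "card ?X \<le> 7 * card ?Y" and Y: "8 ^ card I * card ?Y \<le> 7 ^ card I * 2 ^ card W"
    by (simp_all add: card_cartesian_product)
  have "8 ^ card I * card ?X \<le> 8 ^ card I * (7 * card ?Y)"
    using X by (rule mult_le_mono2)
  also have "\<dots> \<le> 7 * (7 ^ card I * 2 ^ card W)"
    using mult_le_mono2[OF Y, of 7] by (simp add: mult_ac)
  finally show ?case using insert.hyps cU by (simp add: power_add mult_ac)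
qed

text \<open>A subset of these pairs, larger level first, encodes a two-colouring of the pairs of
  levels.\<close>

definition below_pairs :: "nat \<Rightarrow> (nat \<times> nat) set" where
  "below_pairs N = {(p, q). q < p \<and> p < N}"

lemma finite_below_pairs: "finite (below_pairs N)"
  by (rule finite_subset[of _ "{..<N} \<times> {..<N}"]) (auto simp: below_pairs_def)

text \<open>The triples with indices \<open>i\<close>, \<open>t + j\<close>, \<open>2 t + ((i + j) mod t)\<close> form a Latin square, so they
  are pairwise edge-disjoint and their colour patterns are independent.\<close>

lemma card_without_pat:
  assumes "D \<subseteq> {..<N}" "card D = 3 * t"
  shows "8 ^ (t * t) * card {F. F \<subseteq> below_pairs N \<and> \<not> has_pat (\<lambda>x y. (x, y) \<in> F) D}
    \<le> 7 ^ (t * t) * 2 ^ card (below_pairs N)"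
proof -
  have "finite D" using assms(1) finite_subset by blast
  then obtain e where e: "\<And>i. i < 3 * t \<Longrightarrow> e i \<in> D" "\<And>i j. i < j \<Longrightarrow> j < 3 * t \<Longrightarrow> e i < e j"
    using strict_mono_enumeration[of D "3 * t"] assms(2) by (metis order_refl)
  have e_eq: "e x = e y \<longleftrightarrow> x = y" if "x < 3 * t" "y < 3 * t" for x y
    using e(2)[of x y] e(2)[of y x] that by (cases x y rule: linorder_cases) auto
  define g where "g i j = 2 * t + (if i + j < t then i + j else i + j - t)" for i j
  define T where "T = (\<lambda>(i, j). {(e (g i j), e (t + j)), (e (g i j), e i), (e (t + j), e i)})"
  \<comment> \<open>The trace in which only the pair of largest and smallest level is coloured 1:
    the pattern 010.\<close>
  define P where "P = (\<lambda>(i, j). {(e (g i j), e i)})"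
  let ?I = "{..<t} \<times> {..<t}"
  have g: "2 * t \<le> g i j" "g i j < 3 * t" if "i < t" "j < t" for i j
    using that by (auto simp: g_def)
  have lt: "e i < e (t + j)" "e (t + j) < e (g i j)" "e (g i j) < N" if "i < t" "j < t" for i j
    using e(2)[of i "t + j"] e(2)[of "t + j" "g i j"] e(1)[of "g i j"] g[OF that] that assms(1) by auto
  have "8 ^ card ?I * card {F. F \<subseteq> below_pairs N \<and> (\<forall>x\<in>?I. F \<inter> T x \<noteq> P x)}
      \<le> 7 ^ card ?I * 2 ^ card (below_pairs N)"
  proof (rule card_avoiding_blocks)
    fix x assume "x \<in> ?I"
    then obtain i j where x: "x = (i, j)" "i < t" "j < t" by auto
    show "T x \<subseteq> below_pairs N \<and> card (T x) = 3 \<and> P x \<subseteq> T x"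
      using lt[OF x(2,3)] by (auto simp: T_def P_def x(1) below_pairs_def)
  next
    fix x y assume "x \<in> ?I" "y \<in> ?I" "x \<noteq> y"
    then obtain i j i' j' where x: "x = (i, j)" "i < t" "j < t" and y: "y = (i', j')" "i' < t" "j' < t"
      and ne: "i \<noteq> i' \<or> j \<noteq> j'" by auto
    \<comment> \<open>Distinct cells of the Latin square agree in at most one of row, column and
      symbol, so their triples share no pair.\<close>
    have "i = i' \<longleftrightarrow> j = j'" if "g i j = g i' j'"
      using that x y by (auto simp: g_def split: if_splits)
    then show "T x \<inter> T y = {}"
      using x y ne g[OF x(2,3)] g[OF y(2,3)] by (auto simp: T_def e_eq)
  qed (auto simp: finite_below_pairs)
  moreover have "card {F. F \<subseteq> below_pairs N \<and> \<not> has_pat (\<lambda>x y. (x, y) \<in> F) D}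
      \<le> card {F. F \<subseteq> below_pairs N \<and> (\<forall>x\<in>?I. F \<inter> T x \<noteq> P x)}"
  proof (rule card_mono)
    show "finite {F. F \<subseteq> below_pairs N \<and> (\<forall>x\<in>?I. F \<inter> T x \<noteq> P x)}"
      by (rule finite_subset[of _ "Pow (below_pairs N)"]) (auto simp: finite_below_pairs)
    have "has_pat (\<lambda>x y. (x, y) \<in> F) D" if x: "x \<in> ?I" "F \<inter> T x = P x" for F x
    proof -
      obtain i j where ij: "x = (i, j)" "i < t" "j < t" using x by auto
      have F: "z \<in> F \<longleftrightarrow> z = (e (g i j), e i)" if "z \<in> T x" for z
        using x(2) that ij(1) by (auto simp: P_def)
      have "pat (\<lambda>x y. (x, y) \<in> F) (e (g i j)) (e (t + j)) (e i)"
        using F lt[OF ij(2,3)] by (auto simp: pat_def T_def ij(1))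
      moreover have "e i \<in> D" "e (t + j) \<in> D" "e (g i j) \<in> D"
        using e(1) g[OF ij(2,3)] ij by auto
      ultimately show ?thesis using lt[OF ij(2,3)] unfolding has_pat_def by blast
    qed
    then show "{F. F \<subseteq> below_pairs N \<and> \<not> has_pat (\<lambda>x y. (x, y) \<in> F) D}
        \<subseteq> {F. F \<subseteq> below_pairs N \<and> (\<forall>x\<in>?I. F \<inter> T x \<noteq> P x)}" by blast
  qed
  ultimately show ?thesis
    by (simp add: card_cartesian_product) (meson mult_le_mono2 order_trans)
qed

text \<open>Union bound over all \<open>D\<close>, with \<open>t = 16 * k\<close> in
  \<open>card_without_pat\<close>. The factor 16 is the least integer \<open>s\<close> with
  \<open>(8/7)^s > 8\<close>, which is what the final comparison needs.\<close>

lemma pair_colouring_exists: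
  assumes "k \<ge> 1"
  shows "\<exists>\<phi>. \<forall>D. D \<subseteq> {..<2 ^ k} \<longrightarrow> card D = 48 * k \<longrightarrow> has_pat \<phi> D"
proof (rule ccontr)
  assume "\<not> ?thesis"
  then have none: "\<exists>D \<subseteq> {..<2 ^ k}. card D = 48 * k \<and> \<not> has_pat \<phi> D" for \<phi> by auto
  let ?U = "below_pairs (2 ^ k)"
  let ?D = "{D. D \<subseteq> {..<2 ^ k :: nat} \<and> card D = 48 * k}"
  let ?B = "\<lambda>D. {F. F \<subseteq> ?U \<and> \<not> has_pat (\<lambda>x y. (x, y) \<in> F) D}"
  let ?c = "16 * k * (16 * k)"
  have finD: "finite ?D" by (rule finite_subset[of _ "Pow {..<2 ^ k}"]) auto
  have finB: "finite (?B D)" for D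
    by (rule finite_subset[of _ "Pow ?U"]) (auto simp: finite_below_pairs)
  have "Pow ?U \<subseteq> (\<Union>D\<in>?D. ?B D)"
  proof
    fix F assume "F \<in> Pow ?U"
    then show "F \<in> (\<Union>D\<in>?D. ?B D)" using none[of "\<lambda>x y. (x, y) \<in> F"] by auto
  qed
  then have "card (Pow ?U) \<le> card (\<Union>D\<in>?D. ?B D)"
    using finD finB by (intro card_mono) auto
  also have "\<dots> \<le> (\<Sum>D\<in>?D. card (?B D))" by (rule card_UN_le[OF finD])
  finally have "8 ^ ?c * 2 ^ card ?U \<le> (\<Sum>D\<in>?D. 8 ^ ?c * card (?B D))"
    by (simp add: card_Pow finite_below_pairs flip: sum_distrib_left)
  also have "\<dots> \<le> (\<Sum>D\<in>?D. 7 ^ ?c * 2 ^ card ?U)"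
    by (rule sum_mono, rule card_without_pat) auto
  also have "\<dots> = card ?D * (7 ^ ?c * 2 ^ card ?U)" by simp
  also have "card ?D = 2 ^ k choose (48 * k)" using n_subsets[of "{..<2 ^ k :: nat}" "48 * k"] by simp
  \<comment> \<open>If \<open>48 * k > 2 ^ k\<close> there is no such \<open>D\<close> and the
    binomial coefficient is 0.\<close>
  also have "\<dots> \<le> (2 ^ k) ^ (48 * k)"
    by (cases "48 * k \<le> 2 ^ k") (auto intro: binomial_le_pow simp: binomial_eq_0)
  finally have "8 ^ ?c \<le> (2 ^ k) ^ (48 * k) * (7 ^ ?c :: nat)"
    by (simp add: mult.assoc[symmetric])
  also have "\<dots> = (2 ^ 3 * 7 ^ 16) ^ (16 * k * k)"
    unfolding power_mult_distrib power_mult[symmetric] by (simp add: mult_ac)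
  also have "\<dots> < (8 ^ 16) ^ (16 * k * k)"
    using assms by (intro power_strict_mono) auto
  also have "\<dots> = 8 ^ ?c" unfolding power_mult[symmetric] by (simp add: mult_ac)
  finally show False by simp
qed

section \<open>The hypergraph and the lower bound\<close>

lemma sorted_quadruple_unique:
  fixes a b c d :: nat
  assumes "{a, b, c, d} = {a', b', c', d'}" "a < b" "b < c" "c < d" "a' < b'" "b' < c'" "c' < d'"
  shows "a = a' \<and> b = b' \<and> c = c' \<and> d = d'"
  using sorted_distinct_set_unique[of "[a, b, c, d]" "[a', b', c', d']"] assms by simp

text \<open>The constant is 192 = 2 * (48 + 48): two combs of at most \<open>48 * k\<close> vertices
  each, and the factor 2 of \<open>blue_combs\<close>. Allowing every \<open>j\<close> up to
  \<open>2 ^ 2 ^ k\<close> lets the Ramsey number itself be inserted for \<open>j\<close>.\<close>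

lemma not_ramsey_property:
  assumes k: "k \<ge> 1" and n: "n > 192 * k" and j: "j \<le> 2 ^ 2 ^ k"
  shows "\<not> ramsey_property 4 6 n {..<j :: nat}"
proof
  assume R: "ramsey_property 4 6 n {..<j}"
  obtain \<phi> where \<phi>: "\<And>D. D \<subseteq> {..<2 ^ k} \<Longrightarrow> card D = 48 * k \<Longrightarrow> has_pat \<phi> D"
    using pair_colouring_exists[OF k] by blast
  define E where "E = {{u, v, w, x} |u v w x. u < v \<and> v < w \<and> w < x \<and> x < j \<and> red4 \<phi> u v w x}"
  have "kgraph 4 {..<j} E"
    unfolding kgraph_def E_def nsets_def by auto
  then consider S where "S \<in> [{..<j}]\<^bsup>6\<^esup>" "[S]\<^bsup>4\<^esup> \<subseteq> E"
    | I where "independent_set {..<j} E I" "card I = n"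
    using R unfolding ramsey_property_def contains_complete_def by blast
  then show False
  proof cases
    case 1
    show False
    proof (rule no_red_K6)
      show "finite S" "card S = 6" using 1(1) by (auto simp: nsets_def)
      fix u v w x assume q: "{u, v, w, x} \<subseteq> S" "u < v" "v < w" "w < x"
      then have "{u, v, w, x} \<in> [S]\<^bsup>4\<^esup>" by (auto simp: nsets_def)
      then have "{u, v, w, x} \<in> E" using 1(2) by blast
      then obtain u' v' w' x' where "{u, v, w, x} = {u', v', w', x'}" "u' < v'" "v' < w'" "w' < x'"
        "red4 \<phi> u' v' w' x'"
        unfolding E_def by blast
      then show "red4 \<phi> u v w x" using sorted_quadruple_unique q by metis
    qed
  next
    case 2
    have sub: "I \<subseteq> {..<j}" using 2(1) by (simp add: independent_set_def)
    then have sub2: "I \<subseteq> {..<2 ^ 2 ^ k}" using j by auto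
    have fin: "finite I" using sub finite_subset by blast
    have ne: "I \<noteq> {}" using 2(2) n by auto
    have blue: "blue \<phi> I"
      unfolding blue_def
    proof (intro ballI impI notI)
      fix a b c d assume q: "a \<in> I" "b \<in> I" "c \<in> I" "d \<in> I" "a < b" "b < c" "c < d" "red4 \<phi> a b c d"
      then have "{a, b, c, d} \<in> E" using sub unfolding E_def by blast
      then show False using 2(1) q by (auto simp: independent_set_def)
    qed
    obtain A B where AB: "A \<subseteq> I" "B \<subseteq> I" "delta_inc A" "delta_dec B" "card I \<le> 2 * (card A + card B)"
      using blue_combs[OF fin ne blue] by blast
    have "card A \<le> 48 * k"
      using AB(1,3) fin sub2 blue \<phi>
      by (intro delta_inc_blue_bound[of A "2 ^ k" \<phi>]) (auto intro: finite_subset blue_subset)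
    moreover have "card B \<le> 48 * k"
      using AB(2,4) fin sub2 blue \<phi>
      by (intro delta_dec_blue_bound[of B "2 ^ k" \<phi>]) (auto intro: finite_subset blue_subset)
    ultimately show False using AB(5) 2(2) n by simp
  qed
qed

text \<open>The edgeless hypergraph is a counterexample: \<open>j\<close> vertices are too few for
  either alternative.\<close>

lemma not_ramsey_property_small:
  assumes "j < s" "j < n"
  shows "\<not> ramsey_property k s n {..<j :: nat}"
proof
  assume "ramsey_property k s n {..<j}"
  moreover have "kgraph k {..<j} {}" by (simp add: kgraph_def)
  ultimately consider "contains_complete k s {..<j} {}"
    | I where "independent_set {..<j} {} I" "card I = n"
    unfolding ramsey_property_def by blast
  then show False
  proof cases
    case 1
    then obtain S where "S \<subseteq> {..<j}" "card S = s"
      by (auto simp: contains_complete_def nsets_def)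
    then show False using card_mono[of "{..<j}" S] assms by simp
  next
    case 2
    then show False using card_mono[of "{..<j}" I] assms by (simp add: independent_set_def)
  qed
qed

theorem theorem1p2:
  shows "\<exists>c::real. c > 0 \<and>
    (\<forall>n::nat. n \<ge> 5 \<longrightarrow> real (ramsey_number 4 6 n) \<ge> 2 powr (2 powr (c * real n)))"
proof (intro exI[of _ "1 / 400"] conjI allI impI)
  fix n :: nat assume n: "n \<ge> 5"
  define R where "R = ramsey_number 4 6 n"
  have R: "ramsey_property 4 6 n {..<R}"
    unfolding R_def by (rule ramsey_number_attained) auto
  show "real (ramsey_number 4 6 n) \<ge> 2 powr (2 powr (1 / 400 * real n))"
  proof (cases "n \<le> 192")
    case True
    \<comment> \<open>For \<open>n \<le> 192\<close> the claimed bound is at most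
      \<open>2 powr (2 powr 1) = 4\<close>, so \<open>R \<ge> 5\<close> suffices.\<close>
    have "\<not> R < 5" using not_ramsey_property_small[of R 6 n 4] R n by auto
    have "(2::real) powr (2 powr (1 / 400 * real n)) \<le> 2 powr (2 powr 1)"
      using True by (intro powr_mono) auto
    also have "\<dots> \<le> real R" using \<open>\<not> R < 5\<close> by simp
    finally show ?thesis by (simp add: R_def)
  next
    case False
    \<comment> \<open>The largest \<open>k\<close> with \<open>192 * k < n\<close>; using
      \<open>n - 1\<close> makes the inequality strict.\<close>
    define k where "k = (n - 1) div 192"
    have k: "k \<ge> 1" "n > 192 * k" "n \<le> 192 * k + 192"
      using False unfolding k_def by linarith+
    have "\<not> R \<le> 2 ^ 2 ^ k" using not_ramsey_property[OF k(1,2)] R by blast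
    then have "2 ^ 2 ^ k \<le> R" by simp
    \<comment> \<open>Since \<open>k \<ge> 1\<close>,
      \<open>n \<le> 192 * k + 192 \<le> 384 * k\<close>, hence
      \<open>n / 400 \<le> k\<close>.\<close>
    have "(2::real) powr (2 powr (1 / 400 * real n)) \<le> 2 powr (2 powr real k)"
      using k by (intro powr_mono) auto
    also have "\<dots> = real (2 ^ 2 ^ k)"
      using powr_realpow[of 2 "2 ^ k"] by (simp add: powr_realpow)
    also have "\<dots> \<le> real R" using \<open>2 ^ 2 ^ k \<le> R\<close> by (rule of_nat_mono)
    finally show ?thesis by (simp add: R_def)
  qed
qed simp

end
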